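(* Let $A\in\mathbb{R}^{n\times n}$ and let $A V = V H_k + r_k e_k^T$ be a $k$-step randomized Arnoldi factorization with starting vector $v_1 = V(:,1)$ and sketching matrix $\Omega$, such that $H_k$ is unreduced, i.e. $h_{i+1,i}>0$ for $i=1,\dots,k-1$. Then $r_k = 0$ and the columns of $V$ span an invariant subspace of $A$ if and only if $v_1 = Qy$ for some $y\in\mathbb{R}^k$ and some $Q\in\mathbb{R}^{n\times k}$ that is the factor of a $k$ partial $\Omega$-orthonormal Schur factorization $AQ = QR$ of $A$.
   Context: All inner products and norms are Euclidean. For $\Omega\in\mathbb{R}^{d\times n}$: $\Omega$ is an $\epsilon$-embedding for a subspace $\mathcal{S}\subset\mathbb{R}^n$ (with $\epsilon\in[0,1)$) if $(1-\epsilon)\|x\|^2\le\|\Omega x\|^2\le(1+\epsilon)\|x\|^2$ for all $x\in\mathcal{S}$. Vectors $x,y$ are $\Omega$-orthogonal if $(\Omega x)^T(\Omega y)=0$; a matrix $V$ with $k$ columns is $\Omega$-orthonormal if $(\Omega V)^T(\Omega V)=I_k$. Randomized Arnoldi factorization: given $v_1\in\mathbb{R}^n$ with $\|\Omega v_1\|=1$, let $\mathcal{K}_k=\mathrm{span}\{v_1,Av_1,\dots,A^{k-1}v_1\}$ be of dimension $k$ and let $\Omega$ be an $\epsilon$-embedding for $\mathrm{span}\{\mathcal{K}_k, A\mathcal{K}_k\}$. A ($k$-step) randomized Arnoldi factorization is a relation $AV = VH_k + r_k e_k^T$, where $V\in\mathbb{R}^{n\times k}$ is an $\Omega$-orthonormal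 basis of $\mathcal{K}_k$ with $V(:,1)=v_1$, $H_k\in\mathbb{R}^{k\times k}$ is upper Hessenberg with positive subdiagonal entries $h_{i+1,i}$, $r_k=h_{k+1,k}v_{k+1}\in\mathcal{K}_{k+1}$ is $\Omega$-orthogonal to $\mathrm{span}(V)=\mathcal{K}_k$, and $e_k$ is the $k$-th canonical vector of $\mathbb{R}^k$. A $k$ partial $\Omega$-orthonormal Schur factorization of $A$ is a decomposition $AQ=QR$ with $Q\in\mathbb{R}^{n\times k}$ $\Omega$-orthonormal and $R\in\mathbb{R}^{k\times k}$ block upper triangular with diagonal blocks of size $1\times1$ or $2\times 2$. *)

theory Defs
  imports
    Complex_Main
    "Jordan_Normal_Form.Matrix"
    "Jordan_Normal_Form.VS_Connect"
    "Jordan_Normal_Form.DL_Rank"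
begin

text \<open>Matrices and vectors are those of \<^theory>\<open>Jordan_Normal_Form.Matrix\<close>, so all indices start
  at 0: the vector $v_i$ is \<open>col V (i - 1)\<close>, and $e_k$ is \<open>unit_vec k (k - 1)\<close>.\<close>

abbreviation vspan :: "nat \<Rightarrow> real vec set \<Rightarrow> real vec set" where
  "vspan n S \<equiv> LinearCombinations.module.span class_ring (module_vec TYPE(real) n) S"

abbreviation vspan_dim :: "nat \<Rightarrow> real vec set \<Rightarrow> nat" where
  "vspan_dim n S \<equiv> vectorspace.dim (class_ring :: real ring)
     (LinearCombinations.module.span_vs class_ring (module_vec TYPE(real) n) S)"

abbreviation vlin_indpt :: "nat \<Rightarrow> real vec set \<Rightarrow> bool" where
  "vlin_indpt n S \<equiv> LinearCombinations.module.lin_indpt class_ring (module_vec TYPE(real) n) S"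

definition enorm :: "real vec \<Rightarrow> real" where
  "enorm x = sqrt (x \<bullet> x)"

definition outer_prod :: "real vec \<Rightarrow> real vec \<Rightarrow> real mat" where
  "outer_prod u v = mat (dim_vec u) (dim_vec v) (\<lambda>(i, j). u $ i * v $ j)"

definition eps_embedding :: "real \<Rightarrow> real mat \<Rightarrow> real vec set \<Rightarrow> bool" where
  "eps_embedding \<epsilon> \<Omega> S \<longleftrightarrow> 0 \<le> \<epsilon> \<and> \<epsilon> < 1 \<and>
     (\<forall>x\<in>S. (1 - \<epsilon>) * (enorm x)\<^sup>2 \<le> (enorm (\<Omega> *\<^sub>v x))\<^sup>2 \<and>
            (enorm (\<Omega> *\<^sub>v x))\<^sup>2 \<le> (1 + \<epsilon>) * (enorm x)\<^sup>2)"

definition sketch_orthogonal :: "real mat \<Rightarrow> real vec \<Rightarrow> real vec \<Rightarrow> bool" where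
  "sketch_orthogonal \<Omega> x y \<longleftrightarrow> (\<Omega> *\<^sub>v x) \<bullet> (\<Omega> *\<^sub>v y) = 0"

definition sketch_orthonormal :: "real mat \<Rightarrow> real mat \<Rightarrow> bool" where
  "sketch_orthonormal \<Omega> V \<longleftrightarrow> transpose_mat (\<Omega> * V) * (\<Omega> * V) = 1\<^sub>m (dim_col V)"

definition krylov_gens :: "real mat \<Rightarrow> real vec \<Rightarrow> nat \<Rightarrow> real vec set" where
  "krylov_gens A v k = (\<lambda>i. (A ^\<^sub>m i) *\<^sub>v v) ` {..<k}"

definition krylov :: "nat \<Rightarrow> real mat \<Rightarrow> real vec \<Rightarrow> nat \<Rightarrow> real vec set" where
  "krylov n A v k = vspan n (krylov_gens A v k)"

definition upper_hessenberg :: "real mat \<Rightarrow> bool" where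
  "upper_hessenberg H \<longleftrightarrow>
     (\<forall>i < dim_row H. \<forall>j < dim_col H. j + 1 < i \<longrightarrow> H $$ (i, j) = 0)"

definition positive_subdiagonal :: "real mat \<Rightarrow> bool" where
  "positive_subdiagonal H \<longleftrightarrow> (\<forall>i. i + 1 < dim_row H \<longrightarrow> 0 < H $$ (i + 1, i))"

definition basis_of_cols :: "nat \<Rightarrow> real mat \<Rightarrow> real vec set \<Rightarrow> bool" where
  "basis_of_cols n V S \<longleftrightarrow>
     distinct (cols V) \<and> vlin_indpt n (set (cols V)) \<and> vspan n (set (cols V)) = S"

text \<open>The residual \<open>r\<close> is not written as a product $h_{k+1,k} v_{k+1}$: such a factorization
  always exists and puts no constraint on \<open>r\<close> beyond membership in $\mathcal{K}_{k+1}$. Demanding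
  in addition that $v_{k+1}$ be a sketch-normalized vector orthogonal to $\mathcal{K}_k$ would
  rule out the breakdown case $r_k = 0$, $\mathcal{K}_{k+1} = \mathcal{K}_k$.\<close>

definition randomized_arnoldi ::
  "real \<Rightarrow> nat \<Rightarrow> nat \<Rightarrow> nat \<Rightarrow> real mat \<Rightarrow> real mat \<Rightarrow> real vec \<Rightarrow>
   real mat \<Rightarrow> real mat \<Rightarrow> real vec \<Rightarrow> bool" where
  "randomized_arnoldi \<epsilon> n d k A \<Omega> v1 V H r \<longleftrightarrow>
     1 \<le> k \<and>
     A \<in> carrier_mat n n \<and> \<Omega> \<in> carrier_mat d n \<and> v1 \<in> carrier_vec n \<and>
     V \<in> carrier_mat n k \<and> H \<in> carrier_mat k k \<and> r \<in> carrier_vec n \<and>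
     enorm (\<Omega> *\<^sub>v v1) = 1 \<and>
     vspan_dim n (krylov_gens A v1 k) = k \<and>
     eps_embedding \<epsilon> \<Omega>
       (vspan n (krylov n A v1 k \<union> (\<lambda>x. A *\<^sub>v x) ` krylov n A v1 k)) \<and>
     A * V = V * H + outer_prod r (unit_vec k (k - 1)) \<and>
     sketch_orthonormal \<Omega> V \<and> basis_of_cols n V (krylov n A v1 k) \<and> col V 0 = v1 \<and>
     upper_hessenberg H \<and> positive_subdiagonal H \<and>
     r \<in> krylov n A v1 (k + 1) \<and>
     (\<forall>x \<in> krylov n A v1 k. sketch_orthogonal \<Omega> r x)"

definition block_range :: "nat list \<Rightarrow> nat \<Rightarrow> nat set" where
  "block_range bs p = {sum_list (take p bs) ..< sum_list (take (Suc p) bs)}"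

text \<open>The list \<open>bs\<close> holds the sizes of the diagonal blocks, from top left to bottom right.\<close>

definition quasi_upper_triangular :: "real mat \<Rightarrow> bool" where
  "quasi_upper_triangular R \<longleftrightarrow> square_mat R \<and>
     (\<exists>bs. set bs \<subseteq> {1, 2} \<and> sum_list bs = dim_row R \<and>
        (\<forall>p < length bs. \<forall>q < p. \<forall>i \<in> block_range bs p. \<forall>j \<in> block_range bs q.
           R $$ (i, j) = 0))"

definition partial_schur ::
  "nat \<Rightarrow> nat \<Rightarrow> real mat \<Rightarrow> real mat \<Rightarrow> real mat \<Rightarrow> real mat \<Rightarrow> bool" where
  "partial_schur n k A \<Omega> Q R \<longleftrightarrow>
     Q \<in> carrier_mat n k \<and> R \<in> carrier_mat k k \<and> A * Q = Q * R \<and>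
     sketch_orthonormal \<Omega> Q \<and> quasi_upper_triangular R"

definition invariant_subspace :: "real mat \<Rightarrow> real vec set \<Rightarrow> bool" where
  "invariant_subspace A S \<longleftrightarrow> (\<forall>x\<in>S. A *\<^sub>v x \<in> S)"

end

theory Submission
  imports
    Defs
    "Jordan_Normal_Form.Spectral_Radius"
begin

text \<open>
  Both directions rest on the remark that two \<open>\<Omega>\<close>-orthonormal bases of the same
  \<open>k\<close>-dimensional space differ by an orthogonal \<open>k \<times> k\<close> matrix, because
  \<open>(\<Omega> V U)\<^sup>T (\<Omega> V U) = U\<^sup>T U\<close> as soon as \<open>V\<close> is
  \<open>\<Omega>\<close>-orthonormal (\<open>gram_sketch_mult\<close>).

  If \<open>r = 0\<close>, then \<open>A V = V H\<close>, and a real Schur decomposition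
  \<open>H U = U T\<close> of the small matrix lifts to \<open>A (V U) = (V U) T\<close>; the basis
  \<open>Q = V U\<close> is again \<open>\<Omega>\<close>-orthonormal, and \<open>v\<^sub>1\<close>, the first
  column of \<open>V\<close>, has the coordinates \<open>U\<^sup>T e\<^sub>1\<close> in it.

  If conversely \<open>v\<^sub>1 = Q y\<close> with \<open>A Q = Q R\<close>, then
  \<open>A\<^sup>i v\<^sub>1 = Q R\<^sup>i y\<close>, so every Krylov space lies in the range of
  \<open>Q\<close> (\<open>krylov_subset_vspan_cols\<close>). In particular the range of \<open>V\<close>
  does, and by the remark the two ranges coincide (\<open>sketch_orthonormal_vspan_eq\<close>). The
  residual \<open>r\<close> belongs to the next Krylov space, hence to the range of \<open>V\<close>,
  while it is \<open>\<Omega>\<close>-orthogonal to that range; so it is \<open>\<Omega>\<close>-orthogonal to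
  itself and vanishes. Then \<open>A V = V H\<close>, which makes the range of \<open>V\<close> invariant.

  The real Schur decomposition (\<open>real_schur_decomposition\<close>) is obtained by deflation. The
  real and imaginary part of a complex eigenvector span a real invariant subspace of dimension 1
  or 2. Two Householder reflections move that subspace onto the first coordinate axis or axes, after
  which the matrix is block upper triangular with a leading block of that size, and induction
  takes care of the trailing block.
\<close>

section \<open>Orthogonal matrices\<close>

definition orthogonal_matrix :: "nat \<Rightarrow> real mat \<Rightarrow> bool" where
  "orthogonal_matrix k U \<longleftrightarrow> U \<in> carrier_mat k k \<and> U\<^sup>T * U = 1\<^sub>m k"

lemma orthogonal_matrixD:
  assumes "orthogonal_matrix k U"
  shows "U \<in> carrier_mat k k" "U\<^sup>T \<in> carrier_mat k k" "U\<^sup>T * U = 1\<^sub>m k" "U * U\<^sup>T = 1\<^sub>m k"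
  using assms mat_mult_left_right_inverse[of "U\<^sup>T" k U] unfolding orthogonal_matrix_def by auto

lemma orthogonal_matrix_one: "orthogonal_matrix k (1\<^sub>m k)"
  by (simp add: orthogonal_matrix_def)

lemma orthogonal_matrix_transpose:
  assumes "orthogonal_matrix k U"
  shows "orthogonal_matrix k (U\<^sup>T)"
  using orthogonal_matrixD[OF assms] by (simp add: orthogonal_matrix_def)

lemma orthogonal_matrix_mult:
  assumes U: "orthogonal_matrix k U" and W: "orthogonal_matrix k W"
  shows "orthogonal_matrix k (U * W)"
proof -
  note U' = orthogonal_matrixD[OF U] and W' = orthogonal_matrixD[OF W]
  have "(U * W)\<^sup>T * (U * W) = W\<^sup>T * U\<^sup>T * (U * W)"
    using U' W' by (simp add: transpose_mult[of _ k k _ k])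
  also have "\<dots> = W\<^sup>T * (U\<^sup>T * U * W)"
    using U'(1,2) W'(1,2) by (simp add: assoc_mult_mat[of _ k k _ k _ k])
  also have "\<dots> = 1\<^sub>m k" using U' W' by simp
  finally show ?thesis using U' W' by (auto simp: orthogonal_matrix_def)
qed

lemma orthogonal_matrix_block_diag:
  assumes W: "orthogonal_matrix l W"
  shows "orthogonal_matrix (m + l) (four_block_mat (1\<^sub>m m) (0\<^sub>m m l) (0\<^sub>m l m) W)"
proof -
  note W' = orthogonal_matrixD[OF W]
  show ?thesis
    using W' unfolding orthogonal_matrix_def
    by (simp add: transpose_four_block_mat[of _ m m _ l _ l]
        mult_four_block_mat[of _ m m _ l _ l _ _ m _ l])
qed

lemma outer_prod_carrier:
  "u \<in> carrier_vec k \<Longrightarrow> v \<in> carrier_vec l \<Longrightarrow> outer_prod u v \<in> carrier_mat k l"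
  by (simp add: outer_prod_def)

lemma transpose_outer_prod: "(outer_prod u v)\<^sup>T = outer_prod v u"
  by (rule eq_matI) (auto simp: outer_prod_def)

lemma outer_prod_mult_vec:
  assumes "v \<in> carrier_vec k" "x \<in> carrier_vec k"
  shows "outer_prod u v *\<^sub>v x = (v \<bullet> x) \<cdot>\<^sub>v u"
  using assms
  by (intro eq_vecI) (auto simp: outer_prod_def scalar_prod_def sum_distrib_left ac_simps)

lemma outer_prod_mult_outer_prod:
  assumes "v \<in> carrier_vec k" "x \<in> carrier_vec k"
  shows "outer_prod u v * outer_prod x y = (v \<bullet> x) \<cdot>\<^sub>m outer_prod u y"
  using assms
  by (intro eq_matI)
    (auto simp: outer_prod_def scalar_prod_def sum_distrib_left sum_distrib_right ac_simps)

lemma mult_zero_vec: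
  fixes M :: "real mat"
  assumes "M \<in> carrier_mat n k"
  shows "M *\<^sub>v 0\<^sub>v k = 0\<^sub>v n"
  using assms by (intro eq_vecI) auto

lemma mult_unit_vec:
  fixes M :: "real mat"
  assumes "M \<in> carrier_mat n k" "j < k"
  shows "M *\<^sub>v unit_vec k j = col M j"
  using assms by (intro eq_vecI) auto

lemma smult_mat_mult_vec:
  fixes M :: "real mat"
  assumes "M \<in> carrier_mat k l" "x \<in> carrier_vec l"
  shows "(c \<cdot>\<^sub>m M) *\<^sub>v x = c \<cdot>\<^sub>v (M *\<^sub>v x)"
  using assms by (intro eq_vecI) (auto simp: scalar_prod_def sum_distrib_left ac_simps)

definition householder_reflection :: "nat \<Rightarrow> real vec \<Rightarrow> real mat" where
  "householder_reflection k u = 1\<^sub>m k - (2 / (u \<bullet> u)) \<cdot>\<^sub>m outer_prod u u"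

lemma orthogonal_matrix_householder_reflection:
  assumes u: "u \<in> carrier_vec k" and u0: "u \<noteq> 0\<^sub>v k"
  shows "orthogonal_matrix k (householder_reflection k u)"
proof -
  have uu: "u \<bullet> u \<noteq> 0" using u u0 conjugate_square_eq_0_vec[OF u] by simp
  let ?P = "outer_prod u u" and ?s = "2 / (u \<bullet> u)"
  let ?R = "householder_reflection k u"
  have P: "?P \<in> carrier_mat k k" using u by (simp add: outer_prod_carrier)
  have R: "?R \<in> carrier_mat k k" using P by (simp add: householder_reflection_def minus_carrier_mat)
  have sym: "?R\<^sup>T = ?R"
    using u by (intro eq_matI) (auto simp: householder_reflection_def outer_prod_def)
  have "?R * ?R = ?R - ?s \<cdot>\<^sub>m (?P * ?R)"
    unfolding householder_reflection_def using P
    by (subst minus_mult_distrib_mat[of _ k k])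
      (auto intro!: minus_carrier_mat smult_carrier_mat mult_smult_assoc_mat)
  also have "?P * ?R = ?P - ?s \<cdot>\<^sub>m (?P * ?P)"
    unfolding householder_reflection_def using P
    by (subst mult_minus_distrib_mat[of _ k k])
      (auto intro!: minus_carrier_mat smult_carrier_mat mult_smult_distrib)
  also have "?P * ?P = (u \<bullet> u) \<cdot>\<^sub>m ?P"
    by (rule outer_prod_mult_outer_prod[OF u u])
  also have "?R - ?s \<cdot>\<^sub>m (?P - ?s \<cdot>\<^sub>m ((u \<bullet> u) \<cdot>\<^sub>m ?P)) = 1\<^sub>m k"
    using u uu by (intro eq_matI) (auto simp: householder_reflection_def outer_prod_def field_simps)
  finally show ?thesis using R sym by (simp add: orthogonal_matrix_def)
qed

text \<open>Let \<open>c e\<close> be the vector of the same length as \<open>a\<close> along the first axis. The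
  reflection that negates \<open>u = a - c e\<close> exchanges \<open>a\<close> and \<open>c e\<close>: equality of
  the two lengths gives \<open>u \<bullet> u = 2 (u \<bullet> a)\<close>, so the reflection subtracts exactly
  \<open>u\<close> from \<open>a\<close>. If \<open>u\<close> is zero, \<open>a\<close> is already in place.\<close>

lemma orthogonal_to_first_axis:
  assumes a: "a \<in> carrier_vec k"
  shows "\<exists>U. orthogonal_matrix k U \<and> (\<forall>i<k. 0 < i \<longrightarrow> (U *\<^sub>v a) $ i = 0)"
proof (cases "k = 0")
  case True
  then show ?thesis using orthogonal_matrix_one[of k] by auto
next
  case False
  define c where "c = sqrt (a \<bullet> a)"
  have cc: "c * c = a \<bullet> a"
    by (simp add: c_def scalar_prod_def sum_nonneg)
  let ?e = "c \<cdot>\<^sub>v unit_vec k 0"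
  define u where "u = a - ?e"
  have u: "u \<in> carrier_vec k" using a by (simp add: u_def)
  have ea: "?e \<bullet> a = c * a $ 0" and ee: "?e \<bullet> ?e = c * c" and ae: "a \<bullet> ?e = c * a $ 0"
    using a False by simp_all
  have ua: "u \<bullet> a = c * c - c * a $ 0"
    using a cc ea by (simp add: u_def minus_scalar_prod_distrib[of _ k])
  have "u \<bullet> ?e = c * a $ 0 - c * c"
    using a unfolding u_def by (subst minus_scalar_prod_distrib[of _ k]) (use ae ee in auto)
  moreover have "u \<bullet> u = u \<bullet> a - u \<bullet> ?e"
    using a u by (subst (2) u_def) (simp add: scalar_prod_minus_distrib[of _ k])
  ultimately have uu: "u \<bullet> u = 2 * (u \<bullet> a)" using ua by simp
  show ?thesis
  proof (cases "u = 0\<^sub>v k")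
    case True
    have "a $ i = 0" if "i < k" "0 < i" for i
    proof -
      have "u $ i = a $ i" using that a by (simp add: u_def)
      then show ?thesis using True that by simp
    qed
    then show ?thesis using orthogonal_matrix_one[of k] a by (intro exI[of _ "1\<^sub>m k"]) auto
  next
    case False
    have "u \<bullet> u \<noteq> 0" using conjugate_square_eq_0_vec[OF u] False by simp
    then have s: "2 / (u \<bullet> u) * (u \<bullet> a) = 1" using uu by simp
    have "householder_reflection k u *\<^sub>v a = a - (2 / (u \<bullet> u)) \<cdot>\<^sub>v (outer_prod u u *\<^sub>v a)"
      using a u unfolding householder_reflection_def
      by (subst minus_mult_distrib_mat_vec[of _ k k])
        (auto simp: outer_prod_carrier smult_mat_mult_vec[of _ k k])
    also have "outer_prod u u *\<^sub>v a = (u \<bullet> a) \<cdot>\<^sub>v u"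
      using u a by (rule outer_prod_mult_vec)
    also have "a - (2 / (u \<bullet> u)) \<cdot>\<^sub>v ((u \<bullet> a) \<cdot>\<^sub>v u) = a - u"
      using s by (simp only: smult_smult_assoc) simp
    also have "\<dots> = ?e" using a by (auto simp: u_def)
    finally have "householder_reflection k u *\<^sub>v a = ?e" .
    then show ?thesis
      using orthogonal_matrix_householder_reflection[OF u False]
      by (intro exI[of _ "householder_reflection k u"]) auto
  qed
qed

text \<open>After \<open>a\<close> has been brought to the first axis, a second orthogonal matrix that acts
  on the trailing \<open>k - 1\<close> coordinates only takes care of \<open>b\<close>. The image of
  \<open>a\<close> is zero in these coordinates, so it stays on the first axis.\<close>

lemma orthogonal_to_first_two_axes:
  assumes a: "a \<in> carrier_vec k" and b: "b \<in> carrier_vec k"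
  shows "\<exists>U. orthogonal_matrix k U \<and> (\<forall>i<k. 0 < i \<longrightarrow> (U *\<^sub>v a) $ i = 0) \<and>
    (\<forall>i<k. 1 < i \<longrightarrow> (U *\<^sub>v b) $ i = 0)"
proof (cases k)
  case 0
  then show ?thesis using orthogonal_matrix_one[of k] by auto
next
  case (Suc l)
  obtain U where U: "orthogonal_matrix k U" and Ua: "\<And>i. i < k \<Longrightarrow> 0 < i \<Longrightarrow> (U *\<^sub>v a) $ i = 0"
    using orthogonal_to_first_axis[OF a] by blast
  note U' = orthogonal_matrixD[OF U]
  define x where "x = vec_last (U *\<^sub>v b) l"
  obtain W where W: "orthogonal_matrix l W" and Wx: "\<And>i. i < l \<Longrightarrow> 0 < i \<Longrightarrow> (W *\<^sub>v x) $ i = 0"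
    using orthogonal_to_first_axis[of x l] by (auto simp: x_def)
  note W' = orthogonal_matrixD[OF W]
  let ?D = "four_block_mat (1\<^sub>m 1) (0\<^sub>m 1 l) (0\<^sub>m l 1) W"
  have D: "orthogonal_matrix k ?D"
    using orthogonal_matrix_block_diag[OF W, of 1] Suc by simp
  have split: "?D *\<^sub>v y = vec_first y 1 @\<^sub>v (W *\<^sub>v vec_last y l)" if "y \<in> carrier_vec k" for y
  proof -
    have "?D *\<^sub>v (vec_first y 1 @\<^sub>v vec_last y l) = vec_first y 1 @\<^sub>v (W *\<^sub>v vec_last y l)"
      using W' by (subst four_block_mat_mult_vec[of _ 1 1 _ l _ l]) auto
    then show ?thesis using that Suc vec_first_last_append[of y 1 l] by simp
  qed
  have Ua': "vec_last (U *\<^sub>v a) l = 0\<^sub>v l"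
    using Ua U'(1) a Suc by (intro eq_vecI) (auto simp: vec_last_def)
  have "(?D * U *\<^sub>v a) $ i = 0" if "i < k" "0 < i" for i
  proof -
    have "?D * U *\<^sub>v a = ?D *\<^sub>v (U *\<^sub>v a)"
      using U' a orthogonal_matrixD(1)[OF D] by (intro assoc_mult_mat_vec) auto
    also have "\<dots> = vec_first (U *\<^sub>v a) 1 @\<^sub>v 0\<^sub>v l"
      using split[of "U *\<^sub>v a"] U'(1) W'(1) a Ua' mult_zero_vec[OF W'(1)] by simp
    finally show ?thesis using that Suc by simp
  qed
  moreover have "(?D * U *\<^sub>v b) $ i = 0" if "i < k" "1 < i" for i
  proof -
    have "?D * U *\<^sub>v b = ?D *\<^sub>v (U *\<^sub>v b)"
      using U' b orthogonal_matrixD(1)[OF D] by (intro assoc_mult_mat_vec) auto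
    also have "\<dots> = vec_first (U *\<^sub>v b) 1 @\<^sub>v (W *\<^sub>v x)"
      using split[of "U *\<^sub>v b"] U'(1) b by (simp add: x_def)
    finally show ?thesis using that Suc Wx[of "i - 1"] W'(1) by simp
  qed
  ultimately show ?thesis using orthogonal_matrix_mult[OF D U] by blast
qed

section \<open>The real Schur decomposition\<close>

text \<open>In general \<open>a\<close> and \<open>b\<close> are the real and imaginary part of a complex
  eigenvector for the eigenvalue \<open>\<alpha> + \<i> \<beta>\<close>. If the real part vanishes, the
  imaginary part is a real eigenvector for \<open>\<alpha>\<close>; it then serves as \<open>a\<close>, with
  \<open>b = 0\<close> and \<open>\<beta> = 0\<close>.\<close>

lemma real_invariant_pair:
  fixes H :: "real mat"
  assumes H: "H \<in> carrier_mat k k" and k: "0 < k"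
  obtains a b \<alpha> \<beta> where "a \<in> carrier_vec k" "b \<in> carrier_vec k" "a \<noteq> 0\<^sub>v k"
    "H *\<^sub>v a = \<alpha> \<cdot>\<^sub>v a - \<beta> \<cdot>\<^sub>v b" "H *\<^sub>v b = \<beta> \<cdot>\<^sub>v a + \<alpha> \<cdot>\<^sub>v b"
proof -
  let ?C = "map_mat complex_of_real H"
  have "?C \<in> carrier_mat k k" using H by simp
  from spectrum_non_empty[OF this k] obtain l where "eigenvalue ?C l"
    by (auto simp: spectrum_def)
  then obtain z where z: "z \<in> carrier_vec k" "z \<noteq> 0\<^sub>v k" and ev: "?C *\<^sub>v z = l \<cdot>\<^sub>v z"
    using H by (auto simp: eigenvalue_def eigenvector_def)
  define a where "a = map_vec Re z"
  define b where "b = map_vec Im z"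
  have a: "a \<in> carrier_vec k" and b: "b \<in> carrier_vec k" using z by (auto simp: a_def b_def)
  have entry: "(\<Sum>j<k. complex_of_real (H $$ (i, j)) * z $ j) = l * z $ i" if "i < k" for i
    using arg_cong[OF ev, of "\<lambda>v. v $ i"] that H z
    by (simp add: scalar_prod_def atLeast0LessThan)
  have Ha: "H *\<^sub>v a = Re l \<cdot>\<^sub>v a - Im l \<cdot>\<^sub>v b"
  proof (rule eq_vecI)
    fix i assume "i < dim_vec (Re l \<cdot>\<^sub>v a - Im l \<cdot>\<^sub>v b)"
    then have i: "i < k" using b by simp
    show "(H *\<^sub>v a) $ i = (Re l \<cdot>\<^sub>v a - Im l \<cdot>\<^sub>v b) $ i"
      using arg_cong[OF entry[OF i], of Re] i H z
      by (simp add: scalar_prod_def a_def b_def atLeast0LessThan)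
  qed (use H b in auto)
  have Hb: "H *\<^sub>v b = Im l \<cdot>\<^sub>v a + Re l \<cdot>\<^sub>v b"
  proof (rule eq_vecI)
    fix i assume "i < dim_vec (Im l \<cdot>\<^sub>v a + Re l \<cdot>\<^sub>v b)"
    then have i: "i < k" using b by simp
    show "(H *\<^sub>v b) $ i = (Im l \<cdot>\<^sub>v a + Re l \<cdot>\<^sub>v b) $ i"
      using arg_cong[OF entry[OF i], of Im] i H z
      by (simp add: scalar_prod_def a_def b_def atLeast0LessThan algebra_simps)
  qed (use H b in auto)
  show ?thesis
  proof (cases "a = 0\<^sub>v k")
    case False
    then show ?thesis using that a b Ha Hb by blast
  next
    case True
    have "b \<noteq> 0\<^sub>v k"
    proof
      assume b0: "b = 0\<^sub>v k"
      have "z $ i = 0" if "i < k" for i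
        using arg_cong[OF True, of "\<lambda>v. v $ i"] arg_cong[OF b0, of "\<lambda>v. v $ i"] that z
        by (simp add: a_def b_def complex_eq_iff)
      then show False using z by (auto intro: eq_vecI)
    qed
    moreover have "H *\<^sub>v b = Re l \<cdot>\<^sub>v b - 0 \<cdot>\<^sub>v 0\<^sub>v k"
      using Hb b by (auto simp: True)
    moreover have "H *\<^sub>v 0\<^sub>v k = 0 \<cdot>\<^sub>v b + Re l \<cdot>\<^sub>v 0\<^sub>v k"
      using H b by auto
    ultimately show ?thesis using b by (intro that[of b "0\<^sub>v k" "Re l" 0]) auto
  qed
qed

text \<open>Move the pair to \<open>a' = a'\<^sub>0 e\<^sub>0\<close> and
  \<open>b' = b'\<^sub>0 e\<^sub>0 + b'\<^sub>1 e\<^sub>1\<close>. Since \<open>a'\<^sub>0\<close> is nonzero, the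
  two vectors span one axis if \<open>b'\<^sub>1 = 0\<close> and two axes otherwise; this number is
  the block size \<open>m\<close>, and invariance of the span is the vanishing of the entries below
  the leading \<open>m \<times> m\<close> block. Deciding by \<open>b'\<^sub>1\<close> rather than by the
  eigenvalue being real covers linearly dependent \<open>a\<close> and \<open>b\<close> at once.\<close>

lemma orthogonal_deflation:
  assumes H: "H \<in> carrier_mat k k" and k: "0 < k"
  obtains U m where "orthogonal_matrix k U" "m \<in> {1, 2}" "m \<le> k"
    "\<And>i j. m \<le> i \<Longrightarrow> i < k \<Longrightarrow> j < m \<Longrightarrow> (U * H * U\<^sup>T) $$ (i, j) = 0"
proof -
  obtain a b \<alpha> \<beta> where a: "a \<in> carrier_vec k" and b: "b \<in> carrier_vec k" and a0: "a \<noteq> 0\<^sub>v k"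
    and Ha: "H *\<^sub>v a = \<alpha> \<cdot>\<^sub>v a - \<beta> \<cdot>\<^sub>v b" and Hb: "H *\<^sub>v b = \<beta> \<cdot>\<^sub>v a + \<alpha> \<cdot>\<^sub>v b"
    using real_invariant_pair[OF H k] .
  obtain U where U: "orthogonal_matrix k U"
    and Ua: "\<And>i. i < k \<Longrightarrow> 0 < i \<Longrightarrow> (U *\<^sub>v a) $ i = 0"
    and Ub: "\<And>i. i < k \<Longrightarrow> 1 < i \<Longrightarrow> (U *\<^sub>v b) $ i = 0"
    using orthogonal_to_first_two_axes[OF a b] by blast
  note U' = orthogonal_matrixD[OF U]
  define a' where "a' = U *\<^sub>v a"
  define b' where "b' = U *\<^sub>v b"
  define H' where "H' = U * H * U\<^sup>T"
  have c: "a' \<in> carrier_vec k" "b' \<in> carrier_vec k" "H' \<in> carrier_mat k k"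
    using U' H a b by (auto simp: a'_def b'_def H'_def)
  have undo: "U\<^sup>T *\<^sub>v (U *\<^sub>v x) = x" if "x \<in> carrier_vec k" for x
    using that U' by (simp flip: assoc_mult_mat_vec[of _ k k _ k])
  have conj: "H' *\<^sub>v (U *\<^sub>v x) = U *\<^sub>v (H *\<^sub>v x)" if "x \<in> carrier_vec k" for x
  proof -
    have "H' *\<^sub>v (U *\<^sub>v x) = U * H *\<^sub>v (U\<^sup>T *\<^sub>v (U *\<^sub>v x))"
      unfolding H'_def using that U' H by (intro assoc_mult_mat_vec[of _ k k _ k]) auto
    also have "\<dots> = U *\<^sub>v (H *\<^sub>v x)"
      using undo[OF that] that U' H by (simp add: assoc_mult_mat_vec[of _ k k _ k])
    finally show ?thesis .
  qed
  have Ha': "H' *\<^sub>v a' = \<alpha> \<cdot>\<^sub>v a' - \<beta> \<cdot>\<^sub>v b'"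
    unfolding a'_def b'_def conj[OF a] Ha using U' a b
    by (simp add: mult_minus_distrib_mat_vec[of _ k k] mult_mat_vec[of _ k k])
  have Hb': "H' *\<^sub>v b' = \<beta> \<cdot>\<^sub>v a' + \<alpha> \<cdot>\<^sub>v b'"
    unfolding a'_def b'_def conj[OF b] Hb using U' a b
    by (simp add: mult_add_distrib_mat_vec[of _ k k] mult_mat_vec[of _ k k])
  have a'0: "a' $ 0 \<noteq> 0"
  proof
    assume "a' $ 0 = 0"
    then have "a' $ i = 0" if "i < k" for i
      using Ua[OF that] by (cases "i = 0") (auto simp: a'_def)
    then have "a' = 0\<^sub>v k" using c by (intro eq_vecI) auto
    then have "a = 0\<^sub>v k" using undo[OF a] U' by (auto simp: a'_def)
    then show False using a0 by simp
  qed
  have entry: "(H' *\<^sub>v x) $ i = (\<Sum>j<k. H' $$ (i, j) * x $ j)"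
    if "i < k" "x \<in> carrier_vec k" for x i
    using that c by (simp add: scalar_prod_def atLeast0LessThan)
  \<comment> \<open>As \<open>a'\<close> has a single nonzero entry, its image is a multiple of column 0 of \<open>H'\<close>.\<close>
  have col0: "H' $$ (i, 0) * a' $ 0 = \<alpha> * a' $ i - \<beta> * b' $ i" if i: "i < k" for i
  proof -
    have "(H' *\<^sub>v a') $ i = (\<Sum>j\<in>{0}. H' $$ (i, j) * a' $ j)"
      unfolding entry[OF i c(1)]
      using k Ua by (intro sum.mono_neutral_right) (auto simp: a'_def)
    then show ?thesis using Ha' i c by simp
  qed
  show ?thesis
  proof (cases "1 < k \<and> b' $ 1 \<noteq> 0")
    case False
    have zero: "H' $$ (i, j) = 0" if "1 \<le> i" "i < k" "j < 1" for i j
    proof -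
      have "b' $ i = 0" using False Ub[of i] that by (cases "i = 1") (auto simp: b'_def)
      then show ?thesis using col0[of i] Ua[of i] that a'0 by (simp add: a'_def)
    qed
    show ?thesis using that[OF U, of 1] k zero unfolding H'_def by auto
  next
    case True
    have col1: "H' $$ (i, 0) * b' $ 0 + H' $$ (i, 1) * b' $ 1 = \<beta> * a' $ i + \<alpha> * b' $ i"
      if i: "i < k" for i
    proof -
      have "(H' *\<^sub>v b') $ i = (\<Sum>j\<in>{0, 1}. H' $$ (i, j) * b' $ j)"
        unfolding entry[OF i c(2)]
        using True Ub by (intro sum.mono_neutral_right) (auto simp: b'_def)
      then show ?thesis using Hb' i c by simp
    qed
    have zero: "H' $$ (i, j) = 0" if i: "2 \<le> i" "i < k" and j: "j < 2" for i j
    proof -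
      have z: "a' $ i = 0" "b' $ i = 0" using Ua[of i] Ub[of i] i by (auto simp: a'_def b'_def)
      then have 0: "H' $$ (i, 0) = 0" using col0[of i] i a'0 by simp
      then have "H' $$ (i, 1) = 0" using col1[of i] z i True by simp
      with 0 show ?thesis using j by (cases "j = 0") (auto simp: less_2_cases_iff)
    qed
    show ?thesis using that[OF U, of 2] True zero unfolding H'_def by auto
  qed
qed

lemma block_range_Cons_0: "block_range (m # bs) 0 = {0..<m}"
  by (simp add: block_range_def)

lemma block_range_Cons_Suc: "i \<in> block_range (m # bs) (Suc p) \<longleftrightarrow> m \<le> i \<and> i - m \<in> block_range bs p"
  by (auto simp: block_range_def)

lemma block_range_less_sum_list: "i \<in> block_range bs p \<Longrightarrow> i < sum_list bs"
proof -
  assume "i \<in> block_range bs p"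
  then have "i < sum_list (take (Suc p) bs)" by (simp add: block_range_def)
  also have "\<dots> \<le> sum_list (take (Suc p) bs) + sum_list (drop (Suc p) bs)" by simp
  also have "\<dots> = sum_list bs" by (metis append_take_drop_id sum_list_append)
  finally show ?thesis .
qed

lemma quasi_upper_triangular_four_block:
  assumes B: "B \<in> carrier_mat m m" and C: "C \<in> carrier_mat m l" and T: "T \<in> carrier_mat l l"
    and m: "m \<in> {1, 2}" and qt: "quasi_upper_triangular T"
  shows "quasi_upper_triangular (four_block_mat B C (0\<^sub>m l m) T)" (is "quasi_upper_triangular ?F")
proof -
  from qt T obtain bs where bs: "set bs \<subseteq> {1, 2}" "sum_list bs = l"
    and zero: "\<And>p q i j. p < length bs \<Longrightarrow> q < p \<Longrightarrow> i \<in> block_range bs p \<Longrightarrow>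
      j \<in> block_range bs q \<Longrightarrow> T $$ (i, j) = 0"
    unfolding quasi_upper_triangular_def by auto
  have "?F $$ (i, j) = 0"
    if p: "p < length (m # bs)" and q: "q < p"
      and i: "i \<in> block_range (m # bs) p" and j: "j \<in> block_range (m # bs) q" for p q i j
  proof -
    obtain p' where p': "p = Suc p'" using q by (cases p) auto
    have i': "m \<le> i" "i - m \<in> block_range bs p'" using i by (simp_all add: p' block_range_Cons_Suc)
    then have il: "i - m < l" using block_range_less_sum_list bs by blast
    show ?thesis
    proof (cases q)
      case 0
      then show ?thesis using j i' il B C T by (auto simp: block_range_Cons_0)
    next
      case (Suc q')
      then have j': "m \<le> j" "j - m \<in> block_range bs q'"
        using j by (simp_all add: block_range_Cons_Suc)
      then have jl: "j - m < l" using block_range_less_sum_list bs by blast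
      show ?thesis
        using zero[of p' q' "i - m" "j - m"] p q i' j' il jl B C T by (simp add: p' Suc)
    qed
  qed
  then show ?thesis
    unfolding quasi_upper_triangular_def using bs m B T
    by (intro conjI exI[of _ "m # bs"]) auto
qed

theorem real_schur_decomposition:
  assumes "H \<in> carrier_mat k k"
  shows "\<exists>U T. orthogonal_matrix k U \<and> T \<in> carrier_mat k k \<and> H * U = U * T \<and>
    quasi_upper_triangular T"
  using assms
proof (induction k arbitrary: H rule: less_induct)
  case (less k)
  note H = less.prems
  show ?case
  proof (cases "k = 0")
    case True
    have "quasi_upper_triangular H"
      using H True unfolding quasi_upper_triangular_def
      by (auto intro!: exI[of _ "[]"])
    then show ?thesis using H orthogonal_matrix_one[of k] by (intro exI[of _ "1\<^sub>m k"] exI[of _ H]) auto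
  next
    case False
    then obtain U m where U: "orthogonal_matrix k U" and m: "m \<in> {1, 2}" "m \<le> k"
      and zero: "\<And>i j. m \<le> i \<Longrightarrow> i < k \<Longrightarrow> j < m \<Longrightarrow> (U * H * U\<^sup>T) $$ (i, j) = 0"
      using orthogonal_deflation[OF H] by blast
    note U' = orthogonal_matrixD[OF U]
    define l where "l = k - m"
    have k: "k = m + l" using m by (simp add: l_def)
    define H' where "H' = U * H * U\<^sup>T"
    have H': "H' \<in> carrier_mat k k" using U' H by (auto simp: H'_def)
    define B where "B = mat m m (\<lambda>(i, j). H' $$ (i, j))"
    define C where "C = mat m l (\<lambda>(i, j). H' $$ (i, j + m))"
    define D where "D = mat l l (\<lambda>(i, j). H' $$ (i + m, j + m))"
    have c: "B \<in> carrier_mat m m" "C \<in> carrier_mat m l" "D \<in> carrier_mat l l"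
      by (auto simp: B_def C_def D_def)
    have blocks: "H' = four_block_mat B C (0\<^sub>m l m) D"
      using H' zero by (intro eq_matI) (auto simp: B_def C_def D_def k H'_def)
    have "l < k" using m by (auto simp: k)
    from less.IH[OF this c(3)] obtain S T where S: "orthogonal_matrix l S"
      and T: "T \<in> carrier_mat l l" and DS: "D * S = S * T" and qt: "quasi_upper_triangular T"
      by blast
    note S' = orthogonal_matrixD[OF S]
    \<comment> \<open>\<open>?W\<close> makes the trailing block of \<open>H'\<close> quasi upper triangular and keeps the leading one.\<close>
    let ?W = "four_block_mat (1\<^sub>m m) (0\<^sub>m m l) (0\<^sub>m l m) S"
    let ?T = "four_block_mat B (C * S) (0\<^sub>m l m) T"
    have W: "orthogonal_matrix k ?W" using orthogonal_matrix_block_diag[OF S] by (simp add: k)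
    note W' = orthogonal_matrixD[OF W]
    have T': "?T \<in> carrier_mat k k" using c T by (simp add: k)
    have "H' * ?W = four_block_mat B (C * S) (0\<^sub>m l m) (D * S)"
      unfolding blocks using c S'
      by (subst mult_four_block_mat[of _ m m _ l _ l _ _ m _ l]) auto
    also have "\<dots> = ?W * ?T"
      unfolding DS using c S' T
      by (subst mult_four_block_mat[of _ m m _ l _ l _ _ m _ l]) auto
    finally have HW: "H' * ?W = ?W * ?T" .
    have "U\<^sup>T * H' = U\<^sup>T * (U * (H * U\<^sup>T))"
      unfolding H'_def using U'(1,2) H by (subst assoc_mult_mat[of U k k H k]) auto
    also have "\<dots> = U\<^sup>T * U * (H * U\<^sup>T)"
      using U'(1,2) H by (intro assoc_mult_mat[symmetric]) auto
    also have "\<dots> = H * U\<^sup>T" using U' H by simp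
    finally have HU: "H * U\<^sup>T = U\<^sup>T * H'" ..
    have "H * (U\<^sup>T * ?W) = H * U\<^sup>T * ?W"
      using U'(1,2) H W'(1) by (intro assoc_mult_mat[symmetric]) auto
    also have "\<dots> = U\<^sup>T * (H' * ?W)"
      unfolding HU using U'(1,2) H' W'(1) by (intro assoc_mult_mat) auto
    also have "\<dots> = (U\<^sup>T * ?W) * ?T"
      unfolding HW using U'(1,2) W'(1) T' by (intro assoc_mult_mat[symmetric]) auto
    finally have "H * (U\<^sup>T * ?W) = (U\<^sup>T * ?W) * ?T" .
    moreover have "orthogonal_matrix k (U\<^sup>T * ?W)"
      using orthogonal_matrix_mult[OF orthogonal_matrix_transpose[OF U] W] .
    moreover have "quasi_upper_triangular ?T"
      using c S' T m qt by (intro quasi_upper_triangular_four_block) auto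
    ultimately show ?thesis using T' by blast
  qed
qed

section \<open>Column spaces and sketch-orthonormal bases\<close>

lemma vspan_cols:
  assumes "M \<in> carrier_mat n k"
  shows "vspan n (set (cols M)) = {M *\<^sub>v z | z. z \<in> carrier_vec k}"
  using vec_space.col_space_eq[OF assms] assms
  unfolding vec_space.col_space_def by auto

lemma vspan_subset_vspan_cols:
  assumes M: "M \<in> carrier_mat n k" and S: "S \<subseteq> vspan n (set (cols M))"
  shows "vspan n S \<subseteq> vspan n (set (cols M))"
proof -
  interpret vec_space "TYPE(real)" n .
  have "set (cols M) \<subseteq> carrier_vec n" using M cols_dim[of M] by auto
  then show ?thesis using S span_is_submodule span_is_subset by blast
qed

lemma krylov_subset_vspan_cols:
  assumes A: "A \<in> carrier_mat n n" and Q: "Q \<in> carrier_mat n k" and R: "R \<in> carrier_mat k k"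
    and AQ: "A * Q = Q * R" and y: "y \<in> carrier_vec k"
  shows "krylov n A (Q *\<^sub>v y) j \<subseteq> vspan n (set (cols Q))"
proof -
  have "A ^\<^sub>m i * Q = Q * R ^\<^sub>m i" for i
  proof (induction i)
    case (Suc i)
    have "A ^\<^sub>m Suc i * Q = A ^\<^sub>m i * (A * Q)"
      using A Q by (simp add: assoc_mult_mat[of _ n n _ n _ k])
    also have "\<dots> = A ^\<^sub>m i * Q * R"
      unfolding AQ using A Q R by (intro assoc_mult_mat[symmetric]) auto
    also have "\<dots> = Q * (R ^\<^sub>m i * R)"
      unfolding Suc using Q R by (intro assoc_mult_mat) auto
    finally show ?case by simp
  qed (use A Q R in simp)
  moreover have "A ^\<^sub>m i *\<^sub>v (Q *\<^sub>v y) = A ^\<^sub>m i * Q *\<^sub>v y" for i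
    using A Q y by (intro assoc_mult_mat_vec[symmetric]) auto
  moreover have "Q * R ^\<^sub>m i *\<^sub>v y = Q *\<^sub>v (R ^\<^sub>m i *\<^sub>v y)" for i
    using R Q y by (intro assoc_mult_mat_vec) auto
  ultimately have "A ^\<^sub>m i *\<^sub>v (Q *\<^sub>v y) \<in> vspan n (set (cols Q))" for i
    unfolding vspan_cols[OF Q] using mult_mat_vec_carrier[OF pow_carrier_mat[OF R] y] by auto
  then have "krylov_gens A (Q *\<^sub>v y) j \<subseteq> vspan n (set (cols Q))"
    by (auto simp: krylov_gens_def)
  then show ?thesis unfolding krylov_def by (rule vspan_subset_vspan_cols[OF Q])
qed

lemma gram_sketch_mult:
  assumes \<Omega>: "\<Omega> \<in> carrier_mat d n" and V: "V \<in> carrier_mat n k" and U: "U \<in> carrier_mat k l"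
    and on: "sketch_orthonormal \<Omega> V"
  shows "(\<Omega> * (V * U))\<^sup>T * (\<Omega> * (V * U)) = U\<^sup>T * U"
proof -
  have G: "\<Omega> * V \<in> carrier_mat d k" using \<Omega> V by simp
  have "\<Omega> * (V * U) = (\<Omega> * V) * U" using \<Omega> V U by (intro assoc_mult_mat[symmetric]) auto
  then have "(\<Omega> * (V * U))\<^sup>T * (\<Omega> * (V * U)) = U\<^sup>T * (\<Omega> * V)\<^sup>T * ((\<Omega> * V) * U)"
    using transpose_mult[OF G U] by simp
  also have "\<dots> = U\<^sup>T * ((\<Omega> * V)\<^sup>T * (\<Omega> * V) * U)"
    using G U by (simp add: assoc_mult_mat[of "U\<^sup>T" l k _ d _ l] assoc_mult_mat[of _ k d _ k _ l])
  also have "\<dots> = U\<^sup>T * U"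
    using on V U by (simp add: sketch_orthonormal_def)
  finally show ?thesis .
qed

text \<open>Write \<open>V = Q C\<close>: both Gram matrices being the identity forces \<open>C\<close> to be
  orthogonal. As it is square, also \<open>C C\<^sup>T\<close> is the identity, so \<open>Q = V C\<^sup>T\<close>.\<close>

lemma sketch_orthonormal_vspan_eq:
  assumes \<Omega>: "\<Omega> \<in> carrier_mat d n" and Q: "Q \<in> carrier_mat n k" and V: "V \<in> carrier_mat n k"
    and Qon: "sketch_orthonormal \<Omega> Q" and Von: "sketch_orthonormal \<Omega> V"
    and sub: "vspan n (set (cols V)) \<subseteq> vspan n (set (cols Q))"
  shows "vspan n (set (cols V)) = vspan n (set (cols Q))"
proof -
  have "\<exists>z. z \<in> carrier_vec k \<and> col V j = Q *\<^sub>v z" if "j < k" for j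
  proof -
    have "col V j = V *\<^sub>v unit_vec k j" using V that by (simp add: mult_unit_vec[of _ n k])
    then have "col V j \<in> vspan n (set (cols V))" unfolding vspan_cols[OF V] by auto
    then show ?thesis using sub unfolding vspan_cols[OF Q] by blast
  qed
  then obtain f where f: "\<And>j. j < k \<Longrightarrow> f j \<in> carrier_vec k \<and> col V j = Q *\<^sub>v f j" by metis
  define C where "C = mat k k (\<lambda>(i, j). f j $ i)"
  have C: "C \<in> carrier_mat k k" by (simp add: C_def)
  have "col C j = f j" if "j < k" for j using f[OF that] that by (auto simp: C_def)
  then have VQC: "V = Q * C" using f Q V C by (intro mat_col_eqI) auto
  have "orthogonal_matrix k C"
    using gram_sketch_mult[OF \<Omega> Q C Qon] Von V C
    by (simp add: orthogonal_matrix_def sketch_orthonormal_def flip: VQC)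
  note C' = orthogonal_matrixD[OF this]
  have "V * C\<^sup>T = Q * (C * C\<^sup>T)" unfolding VQC using Q C by (intro assoc_mult_mat) auto
  then have QVC: "Q = V * C\<^sup>T" using C' Q by simp
  have "Q *\<^sub>v z = V *\<^sub>v (C\<^sup>T *\<^sub>v z)" if "z \<in> carrier_vec k" for z
    by (subst QVC) (use V C that in \<open>intro assoc_mult_mat_vec, auto\<close>)
  then have "vspan n (set (cols Q)) \<subseteq> vspan n (set (cols V))"
    unfolding vspan_cols[OF Q] vspan_cols[OF V] using C' by fastforce
  with sub show ?thesis by blast
qed

text \<open>A sketch \<open>\<Omega>\<close> may annihilate nonzero vectors, but none in the range of an
  \<open>\<Omega>\<close>-orthonormal matrix \<open>V\<close>, because \<open>(\<Omega> V)\<^sup>T\<close> is a left inverse of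
  \<open>\<Omega> V\<close>.\<close>

lemma sketch_self_orthogonal_in_vspan_eq_0:
  assumes \<Omega>: "\<Omega> \<in> carrier_mat d n" and V: "V \<in> carrier_mat n k"
    and on: "sketch_orthonormal \<Omega> V"
    and x: "x \<in> vspan n (set (cols V))" and orth: "sketch_orthogonal \<Omega> x x"
  shows "x = 0\<^sub>v n"
proof -
  from x obtain z where z: "z \<in> carrier_vec k" and xz: "x = V *\<^sub>v z"
    unfolding vspan_cols[OF V] by blast
  let ?G = "\<Omega> * V"
  have G: "?G \<in> carrier_mat d k" using \<Omega> V by simp
  have Gz: "\<Omega> *\<^sub>v x = ?G *\<^sub>v z"
    unfolding xz using \<Omega> V z by (intro assoc_mult_mat_vec[symmetric]) auto
  have "?G *\<^sub>v z = 0\<^sub>v d"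
    using orth conjugate_square_eq_0_vec[of "?G *\<^sub>v z" d] G z
    by (simp add: sketch_orthogonal_def Gz)
  then have "?G\<^sup>T * ?G *\<^sub>v z = 0\<^sub>v k"
    using G z mult_zero_vec[of "?G\<^sup>T" k d] by (subst assoc_mult_mat_vec[of _ k d _ k]) auto
  then have "z = 0\<^sub>v k" using on V z by (simp add: sketch_orthonormal_def)
  then show ?thesis using xz mult_zero_vec[OF V] by simp
qed

section \<open>Breakdown of the randomized Arnoldi process\<close>

theorem theorem4p1:
  fixes A \<Omega> V H :: "real mat" and v1 r :: "real vec" and \<epsilon> :: real and n d k :: nat
  assumes "randomized_arnoldi \<epsilon> n d k A \<Omega> v1 V H r"
    and "positive_subdiagonal H"
  shows "(r = 0\<^sub>v n \<and> invariant_subspace A (vspan n (set (cols V)))) \<longleftrightarrow>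
    (\<exists>Q R y. partial_schur n k A \<Omega> Q R \<and> y \<in> carrier_vec k \<and> v1 = Q *\<^sub>v y)"
    (is "?breakdown \<longleftrightarrow> ?schur")
proof -
  from assms(1) have k: "1 \<le> k" and A: "A \<in> carrier_mat n n" and \<Omega>: "\<Omega> \<in> carrier_mat d n"
    and V: "V \<in> carrier_mat n k" and H: "H \<in> carrier_mat k k"
    and arnoldi: "A * V = V * H + outer_prod r (unit_vec k (k - 1))"
    and Von: "sketch_orthonormal \<Omega> V" and Vspan: "vspan n (set (cols V)) = krylov n A v1 k"
    and V0: "col V 0 = v1" and r: "r \<in> krylov n A v1 (k + 1)"
    and orth: "\<And>x. x \<in> krylov n A v1 k \<Longrightarrow> sketch_orthogonal \<Omega> r x"
    unfolding randomized_arnoldi_def basis_of_cols_def by blast+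
  have AV: "A * V = V * H" if "r = 0\<^sub>v n"
  proof -
    have "outer_prod r (unit_vec k (k - 1)) = 0\<^sub>m n k"
      using that by (intro eq_matI) (auto simp: outer_prod_def)
    then show ?thesis using arnoldi V H by simp
  qed
  show ?thesis
  proof
    assume ?breakdown
    then have AV: "A * V = V * H" using AV by simp
    obtain U T where U: "orthogonal_matrix k U" and T: "T \<in> carrier_mat k k"
      and HU: "H * U = U * T" and qt: "quasi_upper_triangular T"
      using real_schur_decomposition[OF H] by blast
    note U' = orthogonal_matrixD[OF U]
    have "A * (V * U) = A * V * U" using A V U' by (intro assoc_mult_mat[symmetric]) auto
    also have "\<dots> = V * (H * U)" unfolding AV using V H U' by (intro assoc_mult_mat) auto
    also have "\<dots> = V * U * T" unfolding HU using V T U' by (intro assoc_mult_mat[symmetric]) auto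
    finally have "A * (V * U) = V * U * T" .
    then have "partial_schur n k A \<Omega> (V * U) T"
      using gram_sketch_mult[OF \<Omega> V U'(1) Von] U' V T qt
      by (simp add: partial_schur_def sketch_orthonormal_def)
    moreover have "v1 = V * U *\<^sub>v (U\<^sup>T *\<^sub>v unit_vec k 0)"
    proof -
      have "V * U *\<^sub>v (U\<^sup>T *\<^sub>v unit_vec k 0) = V *\<^sub>v (U *\<^sub>v (U\<^sup>T *\<^sub>v unit_vec k 0))"
        using V U' by (intro assoc_mult_mat_vec) auto
      also have "U *\<^sub>v (U\<^sup>T *\<^sub>v unit_vec k 0) = unit_vec k 0"
        using U' by (simp flip: assoc_mult_mat_vec[of _ k k _ k])
      also have "V *\<^sub>v unit_vec k 0 = v1" using V V0 k by (simp add: mult_unit_vec[of _ n k])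
      finally show ?thesis by simp
    qed
    moreover have "U\<^sup>T *\<^sub>v unit_vec k 0 \<in> carrier_vec k" using U' by simp
    ultimately show ?schur by blast
  next
    assume ?schur
    then obtain Q R y where Q: "Q \<in> carrier_mat n k" and R: "R \<in> carrier_mat k k"
      and AQ: "A * Q = Q * R" and Qon: "sketch_orthonormal \<Omega> Q"
      and y: "y \<in> carrier_vec k" and v1: "v1 = Q *\<^sub>v y"
      unfolding partial_schur_def by blast
    have krylov: "krylov n A v1 j \<subseteq> vspan n (set (cols Q))" for j
      unfolding v1 by (rule krylov_subset_vspan_cols[OF A Q R AQ y])
    then have VQ: "vspan n (set (cols V)) = vspan n (set (cols Q))"
      using sketch_orthonormal_vspan_eq[OF \<Omega> Q V Qon Von] Vspan by simp
    have rV: "r \<in> vspan n (set (cols V))" using r krylov VQ by blast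
    then have r0: "r = 0\<^sub>v n"
      using sketch_self_orthogonal_in_vspan_eq_0[OF \<Omega> V Von rV] orth Vspan by simp
    have "A *\<^sub>v (V *\<^sub>v z) = V *\<^sub>v (H *\<^sub>v z)" if "z \<in> carrier_vec k" for z
    proof -
      have "A *\<^sub>v (V *\<^sub>v z) = A * V *\<^sub>v z"
        using A V that by (intro assoc_mult_mat_vec[symmetric]) auto
      also have "\<dots> = V *\<^sub>v (H *\<^sub>v z)"
        unfolding AV[OF r0] using V H that by (intro assoc_mult_mat_vec) auto
      finally show ?thesis .
    qed
    then have "invariant_subspace A (vspan n (set (cols V)))"
      unfolding vspan_cols[OF V] invariant_subspace_def using H by auto
    with r0 show ?breakdown by simp
  qed
qed

end
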